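(* Let $\theta_1,\theta_2>0$ and $\theta:=\theta_1+\theta_2$. (i) For every Lipschitz continuous $u\in \mathrm{Lip}(\Omega)$, $\mathcal{E}_{\theta}^{\theta_1,\theta_2}(u)<\infty$ (and therefore $\mathcal{E}_{p}^{\theta_1,\theta_2}(u)=0$ for every $0<p<\theta$). (ii) If $u\in C^1(\overline{\Omega})$ and $\mathcal{E}_{\theta}^{\theta_1,\theta_2}(u)=0$, then $u\in S(\Omega)$.
   Context: Setting: $n_1,n_2\ge 1$, $n=n_1+n_2$, $\mathbf{R}^n=X_1\oplus X_2$ with $X_1\perp X_2$ and $\dim X_l=n_l$; each $x\in\mathbf{R}^n$ is written $x=x_1+x_2$ with $x_l\in X_l$. For $l=1,2$, $\Omega_l\subset X_l$ is a non-empty bounded connected open subset of $X_l$, and $\Omega:=\Omega_1+\Omega_2\subset\mathbf{R}^n$. $L(U)$ denotes the space of real-valued Lebesgue-measurable functions on $U$. The set $S(\Omega)$ consists of all $u\in L(\Omega)$ such that for $l=1$ or $l=2$ there is $u_l\in L(\Omega_l)$ with $u(x)=u_l(x_l)$ for almost every $x\in\Omega$. Kernel: $\rho\in L^1(\mathbf{R}^n,[0,\infty))$ is a fixed radial function with $\int\rho=1$ and $\operatorname{supp}\rho\subset B_1$; $\rho_\varepsilon(z):=\varepsilon^{-n}\rho(z/\varepsilon)$. Energies: for $\varepsilon>0$, $\Omega_l^\varepsilon:=\bigcap_{z_l\in X_l,\,|z_l|<\varepsilon}(\Omega_l-z_l)$ and $\Omega^\varepsilon:=\Omega_1^\varepsilon+\Omega_2^\varepsilon$.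 For $p,\theta_1,\theta_2>0$ and $u\in L(\Omega)$, $$\mathcal{E}_{\varepsilon,p}^{\theta_1,\theta_2}(u):=\int_{\mathbf{R}^n}\rho_\varepsilon(z)\int_{\Omega^\varepsilon}\frac{|u(x+z_1)-u(x)|^{\theta_1}\,|u(x+z_2)-u(x)|^{\theta_2}}{|z|^p}\,dx\,dz,\qquad \mathcal{E}_p^{\theta_1,\theta_2}(u):=\liminf_{\varepsilon\downarrow 0}\mathcal{E}_{\varepsilon,p}^{\theta_1,\theta_2}(u).$$ *)

theory Defs
  imports "HOL-Analysis.Analysis"
begin

text \<open>For \<open>x = x1 + x2\<close> with \<open>x1 \<in> X1\<close> and \<open>x2 \<in> X2\<close>, we have \<open>x1 = component X1 X2 x\<close> and
  \<open>x2 = component X2 X1 x\<close>. This is meaningful only when the whole space is the direct sum of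
  \<open>X1\<close> and \<open>X2\<close>.\<close>

definition component :: "'a::euclidean_space set \<Rightarrow> 'a set \<Rightarrow> 'a \<Rightarrow> 'a" where
  "component X Y x = (THE y. y \<in> X \<and> x - y \<in> Y)"

text \<open>Lebesgue measure on a linear subspace \<open>X\<close>, with underlying space \<open>X\<close>. It is built as
  \<open>lborel\<close> and \<open>lebesgue\<close> are, with an orthonormal basis of \<open>X\<close> in place of \<open>Basis\<close>;
  the result does not depend on the basis chosen.\<close>

definition orthonormal_basis_of :: "'a::euclidean_space set \<Rightarrow> 'a set" where
  "orthonormal_basis_of X =
     (SOME B. B \<subseteq> X \<and> pairwise orthogonal B \<and> (\<forall>b\<in>B. norm b = 1) \<and> span B = X)"

definition lebesgue_subspace :: "'a::euclidean_space set \<Rightarrow> 'a measure" where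
  "lebesgue_subspace X =
     completion (distr (Pi\<^sub>M (orthonormal_basis_of X) (\<lambda>_. lborel :: real measure))
       (restrict_space borel X)
       (\<lambda>f. \<Sum>b\<in>orthonormal_basis_of X. f b *\<^sub>R b))"

definition S_functions ::
  "'a::euclidean_space set \<Rightarrow> 'a set \<Rightarrow> 'a set \<Rightarrow> 'a set \<Rightarrow> ('a \<Rightarrow> real) set" where
  "S_functions X1 X2 \<Omega>1 \<Omega>2 =
     {u \<in> borel_measurable (lebesgue_on (\<Omega>1 + \<Omega>2)).
        (\<exists>u1 \<in> borel_measurable (restrict_space (lebesgue_subspace X1) \<Omega>1).
           AE x in lebesgue_on (\<Omega>1 + \<Omega>2). u x = u1 (component X1 X2 x)) \<or>
        (\<exists>u2 \<in> borel_measurable (restrict_space (lebesgue_subspace X2) \<Omega>2).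
           AE x in lebesgue_on (\<Omega>1 + \<Omega>2). u x = u2 (component X2 X1 x))}"

text \<open>Elements of \<open>L\<^sup>1\<close> are only defined up to null sets, so the support and radial symmetry are
  taken in the almost-everywhere sense.\<close>

definition ess_support :: "('a::euclidean_space \<Rightarrow> real) \<Rightarrow> 'a set" where
  "ess_support f = {z. \<forall>r>0. \<not> (AE w in lebesgue. w \<in> ball z r \<longrightarrow> f w = 0)}"

definition radial :: "('a::euclidean_space \<Rightarrow> real) \<Rightarrow> bool" where
  "radial f \<longleftrightarrow> (\<exists>g. AE z in lebesgue. f z = g (norm z))"

definition rescaled :: "('a::euclidean_space \<Rightarrow> real) \<Rightarrow> real \<Rightarrow> 'a \<Rightarrow> real" where
  "rescaled \<rho> \<epsilon> z = \<rho> (z /\<^sub>R \<epsilon>) / \<epsilon> ^ DIM('a)"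

definition inner_domain :: "'a::euclidean_space set \<Rightarrow> 'a set \<Rightarrow> real \<Rightarrow> 'a set" where
  "inner_domain X \<Omega> \<epsilon> = (\<Inter>z\<in>{z \<in> X. norm z < \<epsilon>}. (\<lambda>x. x - z) ` \<Omega>)"

text \<open>The integrals take values in \<open>[0, \<infinity>]\<close>. The value \<open>0\<close> that division by zero gives to the
  integrand at \<open>z = 0\<close> is immaterial, a point being a null set.\<close>

definition energy_eps ::
  "('a::euclidean_space \<Rightarrow> real) \<Rightarrow> 'a set \<Rightarrow> 'a set \<Rightarrow> 'a set \<Rightarrow> 'a set \<Rightarrow>
   real \<Rightarrow> real \<Rightarrow> real \<Rightarrow> real \<Rightarrow> ('a \<Rightarrow> real) \<Rightarrow> ennreal" where
  "energy_eps \<rho> X1 X2 \<Omega>1 \<Omega>2 \<theta>1 \<theta>2 p \<epsilon> u =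
     (\<integral>\<^sup>+ z. ennreal (rescaled \<rho> \<epsilon> z) *
        (\<integral>\<^sup>+ x \<in> inner_domain X1 \<Omega>1 \<epsilon> + inner_domain X2 \<Omega>2 \<epsilon>.
           ennreal (\<bar>u (x + component X1 X2 z) - u x\<bar> powr \<theta>1 *
                    \<bar>u (x + component X2 X1 z) - u x\<bar> powr \<theta>2 / norm z powr p)
         \<partial>lebesgue)
      \<partial>lebesgue)"

definition energy ::
  "('a::euclidean_space \<Rightarrow> real) \<Rightarrow> 'a set \<Rightarrow> 'a set \<Rightarrow> 'a set \<Rightarrow> 'a set \<Rightarrow>
   real \<Rightarrow> real \<Rightarrow> real \<Rightarrow> ('a \<Rightarrow> real) \<Rightarrow> ennreal" where
  "energy \<rho> X1 X2 \<Omega>1 \<Omega>2 \<theta>1 \<theta>2 p u =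
     Liminf (at_right 0) (\<lambda>\<epsilon>. energy_eps \<rho> X1 X2 \<Omega>1 \<Omega>2 \<theta>1 \<theta>2 p \<epsilon> u)"

text \<open>Membership in \<open>C\<^sup>1\<close> of the closure of an open set \<open>U\<close>: \<open>u\<close> is \<open>C\<^sup>1\<close> on \<open>U\<close>, and both \<open>u\<close> and
  its gradient extend continuously to the closure. Only the values of \<open>u\<close> on \<open>U\<close> are used.\<close>

definition C1_closure :: "'a::euclidean_space set \<Rightarrow> ('a \<Rightarrow> real) \<Rightarrow> bool" where
  "C1_closure U u \<longleftrightarrow>
     (\<exists>v g. continuous_on (closure U) v \<and> continuous_on (closure U) g \<and>
        (\<forall>x\<in>U. v x = u x \<and> (u has_derivative (\<lambda>h. g x \<bullet> h)) (at x within U)))"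

end

theory Submission
  imports Defs
begin

text \<open>
  For a Lipschitz function both increments are at most \<open>L * norm z\<close>, so the integrand is at most
  \<open>L powr \<theta> * norm z powr (\<theta> - p)\<close>. The rescaled kernel has mass one and lives on \<open>norm z < \<epsilon>\<close>, which
  bounds the energy at scale \<open>\<epsilon>\<close> by \<open>L powr \<theta> * \<epsilon> powr (\<theta> - p)\<close> times the volume of the bounded
  domain (\<open>energy_eps_le\<close>). This is a constant for \<open>p = \<theta>\<close> and tends to zero for \<open>p < \<theta>\<close>.

  For a \<open>C\<^sup>1\<close> function of zero energy, at each point one of the two partial gradients must
  vanish: otherwise both linearised increments at that point are comparable to \<open>norm z\<close> for \<open>z\<close> in a
  cone which the kernel charges, and by continuity of the gradient the energy stays bounded away from
  zero (\<open>energy_pos\<close>).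

  It remains to see that the same partial gradient vanishes everywhere. Where the first one is
  nonzero, the second one vanishes nearby, so the first one is locally constant in the second variable.
  By connectedness of the second factor it keeps its nonzero value along the whole slice
  (\<open>gradient_const_along_slice\<close>). If both partial gradients were nonzero somewhere, a horizontal and
  a vertical slice would cross at a point where both are nonzero (\<open>gradient_dichotomy\<close>). Finally, a
  function whose partial gradient in one variable vanishes identically is constant in this variable by
  connectedness, hence equals a continuous function of the other.
\<close>

section \<open>Orthogonal decompositions\<close>

text \<open>Two orthogonal subspaces that span the whole space. The situation is symmetric; every result is
  therefore available a second time, with the roles of the two subspaces exchanged, under the
  prefix \<open>swapped\<close>.\<close>

locale orthogonal_split =
  fixes X Y :: "'a::euclidean_space set"
  assumes subspace_X: "subspace X" and subspace_Y: "subspace Y"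
    and sum_UNIV: "X + Y = UNIV"
    and inner_0: "\<And>x y. x \<in> X \<Longrightarrow> y \<in> Y \<Longrightarrow> x \<bullet> y = 0"
begin

lemma orthogonal_split_swap: "orthogonal_split Y X"
proof
  show "Y + X = UNIV" using sum_UNIV by (simp add: add.commute)
  show "x \<bullet> y = 0" if "x \<in> Y" "y \<in> X" for x y
    using inner_0[OF that(2,1)] by (simp add: inner_commute)
qed (simp_all add: subspace_X subspace_Y)

lemma component_add: 
  assumes "x \<in> X" "y \<in> Y" shows "component X Y (x + y) = x"
  unfolding component_def
proof (rule the_equality)
  fix x' assume x': "x' \<in> X \<and> x + y - x' \<in> Y"
  have "x - x' \<in> X" using assms x' subspace_X by (simp add: subspace_diff)
  moreover have "x - x' \<in> Y"
    using subspace_diff[OF subspace_Y, of "x + y - x'" y] assms x' by (simp add: algebra_simps)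
  ultimately have "(x - x') \<bullet> (x - x') = 0" by (rule inner_0)
  then show "x' = x" by simp
qed (use assms in simp)

end

sublocale orthogonal_split \<subseteq> swapped: orthogonal_split Y X
  by (rule orthogonal_split_swap)

context orthogonal_split
begin

lemma component_in: "component X Y z \<in> X" "component Y X z \<in> Y"
  and component_sum: "component X Y z + component Y X z = z"
proof -
  obtain x y where "x \<in> X" "y \<in> Y" "z = x + y"
    using sum_UNIV by (metis UNIV_I set_plus_elim)
  then show "component X Y z \<in> X" "component Y X z \<in> Y" "component X Y z + component Y X z = z"
    using component_add[of x y] swapped.component_add[of y x] by (simp_all add: add.commute)
qed

lemma component_diff: "component X Y (z - w) = component X Y z - component X Y w"
proof -
  have "z - w = (component X Y z - component X Y w) + (component Y X z - component Y X w)"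
    using component_sum[of z] component_sum[of w] by (simp add: algebra_simps)
  then show ?thesis
    using component_add component_in subspace_X subspace_Y by (metis subspace_diff)
qed

lemma norm_component_le: "norm (component X Y z) \<le> norm z"
proof -
  have "(norm (component X Y z))\<^sup>2 \<le> (norm (component X Y z))\<^sup>2 + (norm (component Y X z))\<^sup>2"
    by simp
  also have "\<dots> = (norm z)\<^sup>2"
    using norm_add_Pythagorean[of "component X Y z" "component Y X z"] component_sum[of z]
      inner_0[OF component_in, of z z] by (simp add: orthogonal_def)
  finally show ?thesis by (simp add: power2_le_iff_abs_le)
qed

text \<open>The component map is self-adjoint, so the part of a gradient that acts on increments in \<open>X\<close> is
  its own \<open>X\<close>-component.\<close>

lemma inner_component: "a \<bullet> component X Y z = component X Y a \<bullet> z"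
proof -
  have "a \<bullet> component X Y z = component X Y a \<bullet> component X Y z"
    using component_sum[of a] inner_0[OF component_in, of z a]
    by (metis add.right_neutral inner_add_left inner_commute)
  also have "\<dots> = component X Y a \<bullet> z"
    using component_sum[of z] inner_0[OF component_in, of a z]
    by (metis add.right_neutral inner_add_right)
  finally show ?thesis .
qed

lemma mem_inner_domain: "x \<in> inner_domain X A \<epsilon> \<longleftrightarrow> (\<forall>z\<in>X. norm z < \<epsilon> \<longrightarrow> x + z \<in> A)"
  unfolding inner_domain_def by (force simp: image_iff algebra_simps)

end

context orthogonal_split
begin

lemma inner_domain_sum_shift:
  assumes "x \<in> inner_domain X A \<epsilon> + inner_domain Y B \<epsilon>" "\<epsilon> > 0" "z \<in> X" "norm z < \<epsilon>"
  shows "x + z \<in> A + B"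
proof -
  obtain a b where ab: "x = a + b" "a \<in> inner_domain X A \<epsilon>" "b \<in> inner_domain Y B \<epsilon>"
    using assms(1) by (rule set_plus_elim)
  have "a + z \<in> A" using ab(2) assms(3,4) by (simp add: mem_inner_domain)
  moreover have "b \<in> B" 
    using ab(3) assms(2) swapped.mem_inner_domain[of b B \<epsilon>] subspace_0[OF subspace_Y]
    by (metis add.right_neutral norm_zero)
  ultimately have "(a + z) + b \<in> A + B" by (rule set_plus_intro)
  then show ?thesis using ab(1) by (simp add: ac_simps)
qed

lemma inner_domain_sum_subset:
  assumes "\<epsilon> > 0" shows "inner_domain X A \<epsilon> + inner_domain Y B \<epsilon> \<subseteq> A + B"
  using inner_domain_sum_shift[of _ A \<epsilon> B 0] assms subspace_0[OF subspace_X] by auto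

text \<open>A fixed ball lies in the shrunken domains for all small \<open>\<epsilon>\<close>, which is why the shrinking does no
  harm to lower bounds. The ball of twice the radius leaves room for increments.\<close>

lemma ball_in_inner_domain_sum:
  assumes "openin (top_of_set X) A" "openin (top_of_set Y) B" "x0 \<in> A + B"
  obtains r where "r > 0" "ball x0 (2 * r) \<subseteq> A + B"
    "\<forall>\<epsilon>\<le>r. ball x0 r \<subseteq> inner_domain X A \<epsilon> + inner_domain Y B \<epsilon>"
proof -
  obtain a b where ab: "x0 = a + b" "a \<in> A" "b \<in> B"
    using assms(3) by (rule set_plus_elim)
  have sub: "A \<subseteq> X" "B \<subseteq> Y" using assms by (auto dest: openin_imp_subset)
  obtain r1 where r1: "r1 > 0" "ball a r1 \<inter> X \<subseteq> A"
    using assms(1) ab(2) unfolding openin_contains_ball by blast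
  obtain r2 where r2: "r2 > 0" "ball b r2 \<inter> Y \<subseteq> B"
    using assms(2) ab(3) unfolding openin_contains_ball by blast
  define r where "r = min r1 r2 / 2"
  have r: "r > 0" "2 * r \<le> r1" "2 * r \<le> r2" using r1 r2 by (auto simp: r_def)
  have near: "norm (component X Y x - a) < t" "norm (component Y X x - b) < t" 
    if "x \<in> ball x0 t" for x t
  proof -
    have "component X Y x0 = a" "component Y X x0 = b"
      using ab sub component_add[of a b] swapped.component_add[of b a]
      by (simp_all add: add.commute subset_iff)
    then have "component X Y x - a = component X Y (x - x0)"
      "component Y X x - b = component Y X (x - x0)"
      by (simp_all only: component_diff swapped.component_diff)
    moreover have "norm (x - x0) < t" using that by (simp add: dist_norm norm_minus_commute)
    ultimately show "norm (component X Y x - a) < t" "norm (component Y X x - b) < t"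
      using norm_component_le[of "x - x0"] swapped.norm_component_le[of "x - x0"] by simp_all
  qed
  have "ball x0 (2 * r) \<subseteq> A + B"
  proof
    fix x assume x: "x \<in> ball x0 (2 * r)"
    have "component X Y x \<in> ball a r1 \<inter> X" "component Y X x \<in> ball b r2 \<inter> Y"
      using near[OF x] r component_in[of x] by (simp_all add: dist_norm norm_minus_commute)
    then have "component X Y x \<in> A" "component Y X x \<in> B" using r1(2) r2(2) by blast+
    then show "x \<in> A + B" using component_sum[of x] by (metis set_plus_intro)
  qed
  moreover have "ball x0 r \<subseteq> inner_domain X A \<epsilon> + inner_domain Y B \<epsilon>" if "\<epsilon> \<le> r" for \<epsilon>
  proof
    fix x assume x: "x \<in> ball x0 r"
    have "component X Y x + z \<in> A" if "z \<in> X" "norm z < \<epsilon>" for z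
    proof -
      have "norm (component X Y x + z - a) < 2 * r"
        using norm_triangle_ineq[of "component X Y x - a" z] near(1)[OF x] that \<open>\<epsilon> \<le> r\<close>
        unfolding diff_add_eq by linarith
      then have "component X Y x + z \<in> ball a r1 \<inter> X"
        using r that component_in[of x] subspace_X
        by (simp add: dist_norm norm_minus_commute subspace_add)
      then show ?thesis using r1(2) by blast
    qed
    moreover have "component Y X x + z \<in> B" if "z \<in> Y" "norm z < \<epsilon>" for z
    proof -
      have "norm (component Y X x + z - b) < 2 * r"
        using norm_triangle_ineq[of "component Y X x - b" z] near(2)[OF x] that \<open>\<epsilon> \<le> r\<close>
        unfolding diff_add_eq by linarith
      then have "component Y X x + z \<in> ball b r2 \<inter> Y"
        using r that component_in[of x] subspace_Y
        by (simp add: dist_norm norm_minus_commute subspace_add)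
      then show ?thesis using r2(2) by blast
    qed
    ultimately show "x \<in> inner_domain X A \<epsilon> + inner_domain Y B \<epsilon>"
      using set_plus_intro[of "component X Y x" "inner_domain X A \<epsilon>" "component Y X x" "inner_domain Y B \<epsilon>"]
      by (simp add: mem_inner_domain swapped.mem_inner_domain component_sum)
  qed
  ultimately show ?thesis using that r(1) by blast
qed

lemma open_sum:
  assumes "openin (top_of_set X) A" "openin (top_of_set Y) B"
  shows "open (A + B)"
  unfolding open_contains_ball
proof
  fix x assume "x \<in> A + B"
  from ball_in_inner_domain_sum[OF assms this] obtain r where "r > 0" "ball x (2 * r) \<subseteq> A + B"
    by metis
  then show "\<exists>e>0. ball x e \<subseteq> A + B" by (intro exI[of _ "2 * r"]) auto
qed

end

section \<open>The rescaled kernel\<close>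

lemma nn_integral_lebesgue_scale:
  fixes F :: "'a::euclidean_space \<Rightarrow> ennreal"
  assumes F: "F \<in> borel_measurable lebesgue" and c: "c > 0"
  shows "(\<integral>\<^sup>+ y. F y \<partial>lebesgue) = ennreal (c ^ DIM('a)) * (\<integral>\<^sup>+ z. F (c *\<^sub>R z) \<partial>lebesgue)"
proof -
  have T: "(\<lambda>x::'a. 0 + (\<Sum>j\<in>Basis. (c * (x \<bullet> j)) *\<^sub>R j)) = (*\<^sub>R) c"
    unfolding scaleR_scaleR[symmetric] scaleR_sum_right[symmetric] euclidean_representation by auto
  have "(lebesgue :: 'a measure) = density (distr lebesgue lebesgue ((*\<^sub>R) c)) (\<lambda>_. \<Prod>j\<in>(Basis::'a set). \<bar>c\<bar>)"
    using lebesgue_affine_euclidean[of "\<lambda>_. c" "0::'a"] c unfolding T by simp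
  moreover have "(\<Prod>j\<in>(Basis::'a set). \<bar>c\<bar>) = c ^ DIM('a)"
    using c by simp
  ultimately have "(\<integral>\<^sup>+ y. F y \<partial>lebesgue) =
      (\<integral>\<^sup>+ y. F y \<partial>density (distr lebesgue lebesgue ((*\<^sub>R) c)) (\<lambda>_. ennreal (c ^ DIM('a))))"
    by metis
  also have "\<dots> = (\<integral>\<^sup>+ y. ennreal (c ^ DIM('a)) * F y \<partial>distr lebesgue lebesgue ((*\<^sub>R) c))"
    using F by (subst nn_integral_density) auto
  also have "\<dots> = ennreal (c ^ DIM('a)) * (\<integral>\<^sup>+ z. F (c *\<^sub>R z) \<partial>lebesgue)"
    using F measurable_compose[OF lebesgue_measurable_scaling F, of c]
    by (simp add: nn_integral_cmult nn_integral_distr)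
  finally show ?thesis .
qed

lemma nn_integral_rescaled:
  fixes \<rho> :: "'a::euclidean_space \<Rightarrow> real"
  assumes "\<rho> \<in> borel_measurable lebesgue" "F \<in> borel_measurable lebesgue" and \<epsilon>: "\<epsilon> > 0"
    and nonneg: "\<And>z. \<rho> z \<ge> 0"
  shows "(\<integral>\<^sup>+ z. ennreal (rescaled \<rho> \<epsilon> z) * F (z /\<^sub>R \<epsilon>) \<partial>lebesgue) = (\<integral>\<^sup>+ y. ennreal (\<rho> y) * F y \<partial>lebesgue)"
proof -
  have m: "(\<lambda>y. ennreal (\<rho> y) * F y) \<in> borel_measurable lebesgue" using assms by simp
  have m': "(\<lambda>z. ennreal (\<rho> (z /\<^sub>R \<epsilon>)) * F (z /\<^sub>R \<epsilon>)) \<in> borel_measurable lebesgue"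
    using measurable_compose[OF lebesgue_measurable_scaling m] .
  have "(\<integral>\<^sup>+ y. ennreal (\<rho> y) * F y \<partial>lebesgue)
      = ennreal (inverse \<epsilon> ^ DIM('a)) * (\<integral>\<^sup>+ z. ennreal (\<rho> (z /\<^sub>R \<epsilon>)) * F (z /\<^sub>R \<epsilon>) \<partial>lebesgue)"
    using nn_integral_lebesgue_scale[OF m, of "inverse \<epsilon>"] \<epsilon> by simp
  also have "\<dots> = (\<integral>\<^sup>+ z. ennreal (inverse \<epsilon> ^ DIM('a)) * (ennreal (\<rho> (z /\<^sub>R \<epsilon>)) * F (z /\<^sub>R \<epsilon>)) \<partial>lebesgue)"
    by (rule nn_integral_cmult[symmetric, OF m'])
  also have "\<dots> = (\<integral>\<^sup>+ z. ennreal (rescaled \<rho> \<epsilon> z) * F (z /\<^sub>R \<epsilon>) \<partial>lebesgue)"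
  proof (rule nn_integral_cong)
    fix z :: 'a
    have "rescaled \<rho> \<epsilon> z = inverse \<epsilon> ^ DIM('a) * \<rho> (z /\<^sub>R \<epsilon>)"
      by (simp add: rescaled_def divide_inverse power_inverse)
    then show "ennreal (inverse \<epsilon> ^ DIM('a)) * (ennreal (\<rho> (z /\<^sub>R \<epsilon>)) * F (z /\<^sub>R \<epsilon>))
        = ennreal (rescaled \<rho> \<epsilon> z) * F (z /\<^sub>R \<epsilon>)"
      using \<epsilon> nonneg by (simp only: ennreal_mult zero_le_power inverse_nonnegative_iff_nonnegative less_imp_le mult.assoc)
  qed
  finally show ?thesis by (rule sym)
qed

text \<open>The complement of \<open>S\<close> is covered by balls on which \<open>f\<close> vanishes almost everywhere; by the
  Lindelof property countably many of them suffice.\<close>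

lemma ess_support_AE:
  assumes "ess_support f \<subseteq> S"
  shows "AE z in lebesgue. z \<notin> S \<longrightarrow> f z = 0"
proof -
  define \<F> where "\<F> = {ball z r |z r. AE w in lebesgue. w \<in> ball z r \<longrightarrow> f w = 0}"
  obtain \<F>' where F': "\<F>' \<subseteq> \<F>" "countable \<F>'" "\<Union>\<F>' = \<Union>\<F>"
  proof (rule Lindelof)
    show "open B" if "B \<in> \<F>" for B using that by (auto simp: \<F>_def)
  qed
  have "\<forall>B\<in>\<F>'. AE w in lebesgue. w \<in> B \<longrightarrow> f w = 0" using F'(1) unfolding \<F>_def by blast
  then have "AE w in lebesgue. \<forall>B\<in>\<F>'. w \<in> B \<longrightarrow> f w = 0" using F'(2) by (subst AE_ball_countable)
  moreover have "\<exists>B\<in>\<F>'. z \<in> B" if "z \<notin> S" for z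
  proof -
    have "z \<notin> ess_support f" using that assms by auto
    then obtain r where "r > 0" "AE w in lebesgue. w \<in> ball z r \<longrightarrow> f w = 0"
      unfolding ess_support_def by auto
    then have "ball z r \<in> \<F>" "z \<in> ball z r" unfolding \<F>_def by auto
    then have "z \<in> \<Union>\<F>'" unfolding F'(3) by blast
    then show ?thesis by blast
  qed
  ultimately show ?thesis by (elim eventually_mono) blast
qed

section \<open>Upper bound for Lipschitz functions\<close>

context orthogonal_split
begin

lemma integrand_le:
  assumes u: "L-lipschitz_on (A + B) u"
    and pos: "\<theta>1 > 0" "\<theta>2 > 0" "\<epsilon> > 0" and p: "p \<le> \<theta>1 + \<theta>2" and z: "norm z < \<epsilon>"
    and x: "x \<in> inner_domain X A \<epsilon> + inner_domain Y B \<epsilon>"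
  shows "\<bar>u (x + component X Y z) - u x\<bar> powr \<theta>1 * \<bar>u (x + component Y X z) - u x\<bar> powr \<theta>2
      / norm z powr p \<le> L powr (\<theta>1 + \<theta>2) * \<epsilon> powr (\<theta>1 + \<theta>2 - p)"
proof (cases "z = 0")
  case True
  then show ?thesis by simp
next
  case False
  have L: "L \<ge> 0" using u by (rule lipschitz_on_nonneg)
  have xx: "x \<in> A + B" using inner_domain_sum_subset[OF pos(3)] x by blast
  have "x + component X Y z \<in> A + B"
    using inner_domain_sum_shift[OF x pos(3) component_in(1)] norm_component_le[of z] z by simp
  moreover have "x + component Y X z \<in> A + B"
    using swapped.inner_domain_sum_shift[of x B \<epsilon> A, OF _ pos(3) component_in(2)] x
      swapped.norm_component_le[of z] z by (simp add: add.commute)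
  ultimately have "dist (u (x + component X Y z)) (u x) \<le> L * dist (x + component X Y z) x"
    "dist (u (x + component Y X z)) (u x) \<le> L * dist (x + component Y X z) x"
    using lipschitz_onD[OF u] xx by blast+
  then have 1: "\<bar>u (x + component X Y z) - u x\<bar> \<le> L * norm z" "\<bar>u (x + component Y X z) - u x\<bar> \<le> L * norm z"
    using mult_left_mono[OF norm_component_le[of z] L] mult_left_mono[OF swapped.norm_component_le[of z] L]
    by (auto simp: dist_norm)
  have "\<bar>u (x + component X Y z) - u x\<bar> powr \<theta>1 * \<bar>u (x + component Y X z) - u x\<bar> powr \<theta>2
      \<le> (L * norm z) powr \<theta>1 * (L * norm z) powr \<theta>2"
    using 1 pos by (intro mult_mono powr_mono2) auto
  also have "\<dots> = L powr (\<theta>1 + \<theta>2) * norm z powr (\<theta>1 + \<theta>2)"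
    using L by (simp add: powr_add powr_mult)
  finally have "\<bar>u (x + component X Y z) - u x\<bar> powr \<theta>1 * \<bar>u (x + component Y X z) - u x\<bar> powr \<theta>2
      / norm z powr p \<le> L powr (\<theta>1 + \<theta>2) * norm z powr (\<theta>1 + \<theta>2) / norm z powr p"
    by (intro divide_right_mono) auto
  also have "\<dots> = L powr (\<theta>1 + \<theta>2) * norm z powr (\<theta>1 + \<theta>2 - p)"
    by (simp add: powr_diff)
  also have "\<dots> \<le> L powr (\<theta>1 + \<theta>2) * \<epsilon> powr (\<theta>1 + \<theta>2 - p)"
    using z p by (intro mult_left_mono powr_mono2) auto
  finally show ?thesis .
qed

lemma energy_eps_le:
  assumes A: "openin (top_of_set X) A" and B: "openin (top_of_set Y) B"
    and u: "L-lipschitz_on (A + B) u"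
    and pos: "\<theta>1 > 0" "\<theta>2 > 0" "\<epsilon> > 0" and p: "p \<le> \<theta>1 + \<theta>2"
    and \<rho>: "\<rho> \<in> borel_measurable lebesgue" "\<And>z. \<rho> z \<ge> 0" "(\<integral>\<^sup>+ z. ennreal (\<rho> z) \<partial>lebesgue) = 1"
    and supp: "AE z in lebesgue. 1 \<le> norm z \<longrightarrow> \<rho> z = 0"
  shows "energy_eps \<rho> X Y A B \<theta>1 \<theta>2 p \<epsilon> u
    \<le> ennreal (L powr (\<theta>1 + \<theta>2) * \<epsilon> powr (\<theta>1 + \<theta>2 - p)) * emeasure lebesgue (A + B)"
proof -
  define M where "M = ennreal (L powr (\<theta>1 + \<theta>2) * \<epsilon> powr (\<theta>1 + \<theta>2 - p))"
  define C where "C = M * emeasure lebesgue (A + B)"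
  \<comment> \<open>the kernel does not charge the set where \<open>F\<close> is infinite\<close>
  define F :: "'a \<Rightarrow> ennreal" where "F = (\<lambda>y. C + \<infinity> * indicator {y. 1 \<le> norm y} y)"
  define G where "G z = (\<integral>\<^sup>+ x \<in> inner_domain X A \<epsilon> + inner_domain Y B \<epsilon>.
           ennreal (\<bar>u (x + component X Y z) - u x\<bar> powr \<theta>1 *
                    \<bar>u (x + component Y X z) - u x\<bar> powr \<theta>2 / norm z powr p) \<partial>lebesgue)" for z
  have AB: "A + B \<in> sets lebesgue" using open_sum[OF A B] by (simp add: borel_open)
  have "closed {y::'a. 1 \<le> norm y}"
    by (intro closed_Collect_le continuous_on_const continuous_on_norm_id)
  then have [measurable]: "{y::'a. 1 \<le> norm y} \<in> sets lebesgue"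
    by (simp add: borel_closed)
  have F: "F \<in> borel_measurable lebesgue"
    unfolding F_def by measurable
  have GF: "G z \<le> F (z /\<^sub>R \<epsilon>)" for z
  proof (cases "norm z < \<epsilon>")
    case True
    have "G z \<le> (\<integral>\<^sup>+ x \<in> A + B. M \<partial>lebesgue)"
      unfolding G_def M_def
    proof (rule nn_integral_mono)
      fix x
      show "ennreal (\<bar>u (x + component X Y z) - u x\<bar> powr \<theta>1 *
            \<bar>u (x + component Y X z) - u x\<bar> powr \<theta>2 / norm z powr p)
            * indicator (inner_domain X A \<epsilon> + inner_domain Y B \<epsilon>) x
          \<le> ennreal (L powr (\<theta>1 + \<theta>2) * \<epsilon> powr (\<theta>1 + \<theta>2 - p)) * indicator (A + B) x"
        using integrand_le[OF u pos p True, of x] inner_domain_sum_subset[OF pos(3), of A B]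
        by (auto simp: indicator_def intro!: ennreal_leI)
    qed
    also have "\<dots> = C" unfolding C_def using AB by (simp add: nn_integral_cmult_indicator)
    also have "\<dots> \<le> F (z /\<^sub>R \<epsilon>)" by (simp add: F_def)
    finally show ?thesis .
  next
    case False
    then have "1 \<le> norm (z /\<^sub>R \<epsilon>)" using pos by (simp add: field_simps)
    then show ?thesis by (simp add: F_def)
  qed
  have "energy_eps \<rho> X Y A B \<theta>1 \<theta>2 p \<epsilon> u = (\<integral>\<^sup>+ z. ennreal (rescaled \<rho> \<epsilon> z) * G z \<partial>lebesgue)"
    by (simp add: energy_eps_def G_def)
  also have "\<dots> \<le> (\<integral>\<^sup>+ z. ennreal (rescaled \<rho> \<epsilon> z) * F (z /\<^sub>R \<epsilon>) \<partial>lebesgue)"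
    by (intro nn_integral_mono mult_left_mono GF) auto
  also have "\<dots> = (\<integral>\<^sup>+ y. ennreal (\<rho> y) * F y \<partial>lebesgue)"
    by (rule nn_integral_rescaled[OF \<rho>(1) F pos(3) \<rho>(2)])
  also have "\<dots> = (\<integral>\<^sup>+ y. ennreal (\<rho> y) * C \<partial>lebesgue)"
    using supp by (intro nn_integral_cong_AE, elim eventually_mono) (auto simp: F_def indicator_def)
  also have "\<dots> = C" using \<rho> by (simp add: nn_integral_multc)
  finally show ?thesis by (simp add: C_def M_def)
qed

end

section \<open>Lower bound at points where both partial gradients are nonzero\<close>

text \<open>Since hyperplanes are null sets, a kernel of positive mass charges a bounded piece of a double
  cone that stays away from the two hyperplanes orthogonal to \<open>a\<close> and \<open>b\<close>.\<close>

lemma exists_cone_mass: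
  fixes \<rho> :: "'a::euclidean_space \<Rightarrow> real"
  assumes \<rho>: "\<rho> \<in> borel_measurable lebesgue" "(\<integral>\<^sup>+ z. ennreal (\<rho> z) \<partial>lebesgue) \<noteq> 0"
    and a: "a \<noteq> 0" and b: "b \<noteq> 0"
  obtains k :: real and K where "k > 0" "K \<in> sets lebesgue"
    "\<forall>z\<in>K. z \<noteq> 0 \<and> norm z \<le> k \<and> norm z \<le> k * \<bar>a \<bullet> z\<bar> \<and> norm z \<le> k * \<bar>b \<bullet> z\<bar>"
    "(\<integral>\<^sup>+ z. ennreal (\<rho> z) * indicator K z \<partial>lebesgue) \<noteq> 0"
proof -
  define K where "K n = {z. norm z \<le> Suc n \<and> norm z \<le> Suc n * \<bar>a \<bullet> z\<bar> \<and> norm z \<le> Suc n * \<bar>b \<bullet> z\<bar>} - {0}" for n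
  have K: "K n \<in> sets lebesgue" for n
  proof -
    have "closed {z. norm z \<le> Suc n \<and> norm z \<le> Suc n * \<bar>a \<bullet> z\<bar> \<and> norm z \<le> Suc n * \<bar>b \<bullet> z\<bar>}"
      by (intro closed_Collect_conj closed_Collect_le continuous_intros)
    then show ?thesis unfolding K_def by (intro sets.Diff) (simp_all add: borel_closed)
  qed
  have "\<exists>n. (\<integral>\<^sup>+ z. ennreal (\<rho> z) * indicator (K n) z \<partial>lebesgue) \<noteq> 0"
  proof (rule ccontr)
    assume "\<nexists>n. (\<integral>\<^sup>+ z. ennreal (\<rho> z) * indicator (K n) z \<partial>lebesgue) \<noteq> 0"
    then have "\<And>n. AE z in lebesgue. ennreal (\<rho> z) * indicator (K n) z = 0"
      using K \<rho> by (subst nn_integral_0_iff_AE[symmetric]) auto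
    then have "AE z in lebesgue. \<forall>n. ennreal (\<rho> z) * indicator (K n) z = 0"
      unfolding AE_all_countable by blast
    moreover have "AE z in lebesgue. c \<bullet> z \<noteq> 0" if "c \<noteq> 0" for c :: 'a
      using negligible_hyperplane[of c 0] that
      by (intro AE_I'[of "{z. c \<bullet> z = 0}"]) (auto simp: negligible_iff_null_sets)
    ultimately have "AE z in lebesgue. (\<forall>n. ennreal (\<rho> z) * indicator (K n) z = 0) \<and> a \<bullet> z \<noteq> 0 \<and> b \<bullet> z \<noteq> 0"
      using a b by (intro AE_conjI)
    then have "AE z in lebesgue. ennreal (\<rho> z) = 0"
    proof (rule eventually_mono)
      fix z assume *: "(\<forall>n. ennreal (\<rho> z) * indicator (K n) z = 0) \<and> a \<bullet> z \<noteq> 0 \<and> b \<bullet> z \<noteq> 0"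
      obtain n where n: "max (norm z) (max (norm z / \<bar>a \<bullet> z\<bar>) (norm z / \<bar>b \<bullet> z\<bar>)) < real n"
        using reals_Archimedean2 by blast
      then have "norm z / \<bar>a \<bullet> z\<bar> \<le> real (Suc n)" "norm z / \<bar>b \<bullet> z\<bar> \<le> real (Suc n)" by auto
      then have "norm z \<le> real (Suc n) * \<bar>a \<bullet> z\<bar>" "norm z \<le> real (Suc n) * \<bar>b \<bullet> z\<bar>"
        using * by (simp_all only: divide_le_eq zero_less_abs_iff not_False_eq_True if_True)
      moreover have "norm z \<le> real (Suc n)" "z \<noteq> 0" using n * by auto
      ultimately have "z \<in> K n" unfolding K_def by blast
      then show "ennreal (\<rho> z) = 0" using * by (metis indicator_simps(1) mult.right_neutral)
    qed
    then have "(\<integral>\<^sup>+ z. ennreal (\<rho> z) \<partial>lebesgue) = 0"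
      using \<rho> by (subst nn_integral_0_iff_AE) auto
    then show False using \<rho> by simp
  qed
  then obtain n where "(\<integral>\<^sup>+ z. ennreal (\<rho> z) * indicator (K n) z \<partial>lebesgue) \<noteq> 0" ..
  then show ?thesis by (intro that[of "Suc n" "K n"]) (auto simp: K K_def)
qed

lemma increment_near_linear:
  fixes u :: "'a::euclidean_space \<Rightarrow> real"
  assumes deriv: "\<And>x. x \<in> S \<Longrightarrow> (u has_derivative (\<lambda>h. g x \<bullet> h)) (at x)"
    and S: "convex S" "x0 \<in> S" "x \<in> S" "x + h \<in> S"
    and g: "\<And>x. x \<in> S \<Longrightarrow> norm (g x - g x0) \<le> \<delta>"
  shows "\<bar>u (x + h) - u x - g x0 \<bullet> h\<bar> \<le> \<delta> * norm h"
proof -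
  have "norm (u (x + h) - u x - g x0 \<bullet> (x + h - x)) \<le> norm (x + h - x) * \<delta>"
  proof (rule differentiable_bound_linearization[where f' = "\<lambda>x h. g x \<bullet> h" and S = S])
    show "x + t *\<^sub>R (x + h - x) \<in> S" if "t \<in> {0..1}" for t
      using convexD[OF S(1) S(3,4), of "1 - t" t] that by (simp add: algebra_simps)
    show "(u has_derivative (\<bullet>) (g y)) (at y within S)" if "y \<in> S" for y
      using deriv[OF that] by (rule has_derivative_at_withinI)
    show "onorm ((\<bullet>) (g y) - (\<bullet>) (g x0)) \<le> \<delta>" if "y \<in> S" for y
    proof (rule onorm_le)
      fix h
      have "norm (((\<bullet>) (g y) - (\<bullet>) (g x0)) h) = \<bar>(g y - g x0) \<bullet> h\<bar>"
        by (simp add: inner_diff_left)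
      also have "\<dots> \<le> norm (g y - g x0) * norm h" by (rule Cauchy_Schwarz_ineq2)
      also have "\<dots> \<le> \<delta> * norm h" using g[OF that] by (rule mult_right_mono) simp
      finally show "norm (((\<bullet>) (g y) - (\<bullet>) (g x0)) h) \<le> \<delta> * norm h" .
    qed
  qed (use S in simp)
  then show ?thesis by (simp add: mult.commute)
qed

context orthogonal_split
begin

text \<open>Near \<open>x0\<close> the gradient differs from \<open>g x0\<close> by at most \<open>\<delta>\<close>, whereas for \<open>z\<close> in the cone both
  linearised increments at \<open>x0\<close> are at least \<open>2 * \<delta> * norm z\<close>. So both increments of \<open>u\<close> are at least
  \<open>\<delta> * norm z\<close>. As the cone conditions are homogeneous in \<open>z\<close>, this bounds the energy at every
  small scale \<open>\<epsilon>\<close> below by a positive constant that does not depend on \<open>\<epsilon>\<close>.\<close>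

lemma energy_pos:
  assumes A: "openin (top_of_set X) A" and B: "openin (top_of_set Y) B"
    and deriv: "\<And>x. x \<in> A + B \<Longrightarrow> (u has_derivative (\<lambda>h. g x \<bullet> h)) (at x)"
    and g: "continuous_on (A + B) g"
    and x0: "x0 \<in> A + B" and h: "h \<in> X" "g x0 \<bullet> h \<noteq> 0" and k: "k \<in> Y" "g x0 \<bullet> k \<noteq> 0"
    and \<rho>: "\<rho> \<in> borel_measurable lebesgue" "\<And>z. \<rho> z \<ge> 0" "(\<integral>\<^sup>+ z. ennreal (\<rho> z) \<partial>lebesgue) \<noteq> 0"
    and pos: "\<theta>1 > 0" "\<theta>2 > 0"
  shows "energy \<rho> X Y A B \<theta>1 \<theta>2 (\<theta>1 + \<theta>2) u \<noteq> 0"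
proof -
  define a where "a = component X Y (g x0)"
  define b where "b = component Y X (g x0)"
  have "a \<bullet> h \<noteq> 0" using h component_add[OF h(1) subspace_0[OF subspace_Y]] inner_component[of "g x0" h]
    by (simp add: a_def)
  then have a: "a \<noteq> 0" by auto
  have "b \<bullet> k \<noteq> 0" using k swapped.component_add[OF k(1) subspace_0[OF subspace_X]] swapped.inner_component[of "g x0" k]
    by (simp add: b_def)
  then have b: "b \<noteq> 0" by auto
  obtain \<kappa> K where \<kappa>: "\<kappa> > 0" and Ks: "K \<in> sets lebesgue" and
    K: "\<forall>z\<in>K. z \<noteq> 0 \<and> norm z \<le> \<kappa> \<and> norm z \<le> \<kappa> * \<bar>a \<bullet> z\<bar> \<and> norm z \<le> \<kappa> * \<bar>b \<bullet> z\<bar>" and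
    mass: "(\<integral>\<^sup>+ z. ennreal (\<rho> z) * indicator K z \<partial>lebesgue) \<noteq> 0"
    by (rule exists_cone_mass[OF \<rho>(1,3) a b])
  \<comment> \<open>half of the slope \<open>1 / \<kappa>\<close> that the cone conditions guarantee\<close>
  define \<delta> where "\<delta> = 1 / (2 * \<kappa>)"
  have \<delta>: "\<delta> > 0" using \<kappa> by (simp add: \<delta>_def)
  obtain r0 where r0: "r0 > 0" "ball x0 (2 * r0) \<subseteq> A + B"
    "\<forall>\<epsilon>\<le>r0. ball x0 r0 \<subseteq> inner_domain X A \<epsilon> + inner_domain Y B \<epsilon>"
    by (rule ball_in_inner_domain_sum[OF A B x0])
  have "\<exists>d>0. \<forall>x\<in>A + B. dist x x0 < d \<longrightarrow> dist (g x) (g x0) < \<delta>"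
    using g x0 \<delta> unfolding continuous_on_iff by blast
  then obtain d where d: "d > 0" "\<And>x. x \<in> A + B \<Longrightarrow> dist x x0 < d \<Longrightarrow> dist (g x) (g x0) < \<delta>"
    by blast
  define r where "r = min r0 (d / 2)"
  have r: "r > 0" "r \<le> r0" "2 * r \<le> d" using r0 d by (auto simp: r_def)
  have ball: "ball x0 (2 * r) \<subseteq> A + B" using r r0(2) by (auto simp: subset_iff)
  have near: "norm (g x - g x0) \<le> \<delta>" if "x \<in> ball x0 (2 * r)" for x
    using d(2)[of x] ball that r by (auto simp: dist_norm norm_minus_commute)
  define c where "c = ennreal (\<delta> powr (\<theta>1 + \<theta>2)) * emeasure lebesgue (ball x0 r)"
  have "emeasure lebesgue (ball x0 r) \<noteq> 0"
    using open_not_negligible[of "ball x0 r"] r(1) by (simp add: negligible_iff_emeasure0 borel_open)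
  then have "c \<noteq> 0" using \<delta> by (simp add: c_def)

  have incr: "\<delta> * norm z \<le> \<bar>u (x + z') - u x\<bar>"
    if "x \<in> ball x0 r" "norm z < r" "norm z' \<le> norm z" "norm z \<le> \<kappa> * \<bar>g x0 \<bullet> z'\<bar>" for x z z'
  proof -
    have "x + z' \<in> ball x0 (2 * r)"
      using norm_triangle_ineq[of "x - x0" z'] that
      by (simp add: dist_norm norm_minus_commute[of x0] diff_add_eq)
    then have "\<bar>u (x + z') - u x - g x0 \<bullet> z'\<bar> \<le> \<delta> * norm z'"
      using that r deriv ball near by (intro increment_near_linear[of "ball x0 (2 * r)"]) auto
    also have "\<dots> \<le> \<delta> * norm z" using that \<delta> by simp
    finally have "\<bar>g x0 \<bullet> z'\<bar> - \<delta> * norm z \<le> \<bar>u (x + z') - u x\<bar>" by linarith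
    moreover have "2 * \<delta> * norm z \<le> \<bar>g x0 \<bullet> z'\<bar>"
      using that \<kappa> by (simp add: \<delta>_def field_simps)
    ultimately show ?thesis by linarith
  qed

  have lower: "c * (\<integral>\<^sup>+ y. ennreal (\<rho> y) * indicator K y \<partial>lebesgue)
      \<le> energy_eps \<rho> X Y A B \<theta>1 \<theta>2 (\<theta>1 + \<theta>2) \<epsilon> u" if \<epsilon>: "0 < \<epsilon>" "\<epsilon> < min r (r / \<kappa>)" for \<epsilon>
  proof -
    define G where "G z = (\<integral>\<^sup>+ x \<in> inner_domain X A \<epsilon> + inner_domain Y B \<epsilon>.
           ennreal (\<bar>u (x + component X Y z) - u x\<bar> powr \<theta>1 *
                    \<bar>u (x + component Y X z) - u x\<bar> powr \<theta>2 / norm z powr (\<theta>1 + \<theta>2)) \<partial>lebesgue)" for z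
    have "c * indicator K (z /\<^sub>R \<epsilon>) \<le> G z" for z
    proof (cases "z /\<^sub>R \<epsilon> \<in> K")
      case True
      have z: "z \<noteq> 0" "norm z \<le> \<kappa> * \<bar>a \<bullet> z\<bar>" "norm z \<le> \<kappa> * \<bar>b \<bullet> z\<bar>"
        using bspec[OF K True] \<epsilon> by (auto simp: divide_simps abs_mult)
      have "norm z \<le> \<kappa> * \<epsilon>" using bspec[OF K True] \<epsilon> by (simp add: field_simps)
      also have "\<dots> < r" using \<epsilon> \<kappa> by (simp add: field_simps)
      finally have zr: "norm z < r" .
      have "ennreal (\<delta> powr (\<theta>1 + \<theta>2)) * indicator (ball x0 r) x \<le>
          ennreal (\<bar>u (x + component X Y z) - u x\<bar> powr \<theta>1 *
                    \<bar>u (x + component Y X z) - u x\<bar> powr \<theta>2 / norm z powr (\<theta>1 + \<theta>2))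
          * indicator (inner_domain X A \<epsilon> + inner_domain Y B \<epsilon>) x" for x
      proof (cases "x \<in> ball x0 r")
        case x: True
        have "x \<in> inner_domain X A \<epsilon> + inner_domain Y B \<epsilon>"
          using r0(3)[rule_format, of \<epsilon>] \<epsilon> r x by (auto simp: subset_iff)
        moreover have "\<delta> powr (\<theta>1 + \<theta>2) \<le> \<bar>u (x + component X Y z) - u x\<bar> powr \<theta>1 *
                    \<bar>u (x + component Y X z) - u x\<bar> powr \<theta>2 / norm z powr (\<theta>1 + \<theta>2)"
        proof -
          have "\<delta> powr (\<theta>1 + \<theta>2) * norm z powr (\<theta>1 + \<theta>2) = (\<delta> * norm z) powr \<theta>1 * (\<delta> * norm z) powr \<theta>2"
            using \<delta> by (simp add: powr_add powr_mult)
          also have "\<dots> \<le> \<bar>u (x + component X Y z) - u x\<bar> powr \<theta>1 * \<bar>u (x + component Y X z) - u x\<bar> powr \<theta>2"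
            using incr[OF x zr norm_component_le] incr[OF x zr swapped.norm_component_le] z \<delta> pos
            by (intro mult_mono powr_mono2) (auto simp: inner_component swapped.inner_component a_def b_def)
          finally show ?thesis using z by (simp add: pos_le_divide_eq)
        qed
        ultimately show ?thesis using x by (auto intro!: ennreal_leI)
      qed simp
      then have "(\<integral>\<^sup>+ x. ennreal (\<delta> powr (\<theta>1 + \<theta>2)) * indicator (ball x0 r) x \<partial>lebesgue) \<le> G z"
        unfolding G_def by (rule nn_integral_mono)
      then show ?thesis using True by (simp add: c_def nn_integral_cmult_indicator)
    qed simp
    then have "(\<integral>\<^sup>+ z. ennreal (rescaled \<rho> \<epsilon> z) * (c * indicator K (z /\<^sub>R \<epsilon>)) \<partial>lebesgue)
        \<le> (\<integral>\<^sup>+ z. ennreal (rescaled \<rho> \<epsilon> z) * G z \<partial>lebesgue)"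
      by (intro nn_integral_mono mult_left_mono) auto
    moreover have "(\<integral>\<^sup>+ z. ennreal (rescaled \<rho> \<epsilon> z) * (c * indicator K (z /\<^sub>R \<epsilon>)) \<partial>lebesgue)
        = (\<integral>\<^sup>+ y. ennreal (\<rho> y) * (c * indicator K y) \<partial>lebesgue)"
      using Ks \<epsilon>(1) \<rho>(1,2) by (intro nn_integral_rescaled) (simp_all, measurable)
    moreover have "(\<integral>\<^sup>+ y. ennreal (\<rho> y) * (c * indicator K y) \<partial>lebesgue)
        = c * (\<integral>\<^sup>+ y. ennreal (\<rho> y) * indicator K y \<partial>lebesgue)"
      using Ks \<rho> by (subst nn_integral_cmult[symmetric]) (auto simp: ac_simps)
    ultimately show ?thesis by (simp add: energy_eps_def G_def)
  qed
  have "c * (\<integral>\<^sup>+ y. ennreal (\<rho> y) * indicator K y \<partial>lebesgue) \<le> energy \<rho> X Y A B \<theta>1 \<theta>2 (\<theta>1 + \<theta>2) u"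
    unfolding energy_def
  proof (rule Liminf_bounded)
    have "0 < min r (r / \<kappa>)" using r \<kappa> by simp
    then show "\<forall>\<^sub>F \<epsilon> in at_right 0. c * (\<integral>\<^sup>+ y. ennreal (\<rho> y) * indicator K y \<partial>lebesgue)
      \<le> energy_eps \<rho> X Y A B \<theta>1 \<theta>2 (\<theta>1 + \<theta>2) \<epsilon> u"
      unfolding eventually_at_right_field using lower by blast
  qed
  then show ?thesis using mass \<open>c \<noteq> 0\<close> by auto
qed

end

section \<open>Functions one of whose partial gradients vanishes at each point\<close>

lemma has_real_derivative_along_line:
  fixes u :: "'a::euclidean_space \<Rightarrow> real"
  assumes "(u has_derivative (\<lambda>h. w \<bullet> h)) (at (p + t *\<^sub>R v))"
  shows "((\<lambda>s. u (p + s *\<^sub>R v)) has_real_derivative w \<bullet> v) (at t)"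
proof -
  have "((\<lambda>s. p + s *\<^sub>R v) has_derivative (\<lambda>s. s *\<^sub>R v)) (at t)"
    by (auto intro!: derivative_eq_intros)
  from has_derivative_compose[OF this assms]
  show ?thesis unfolding has_field_derivative_def by (rule has_derivative_eq_rhs) auto
qed

lemma eq_of_orthogonal_gradient:
  fixes u :: "'a::euclidean_space \<Rightarrow> real"
  assumes deriv: "\<And>x. x \<in> S \<Longrightarrow> (u has_derivative (\<lambda>h. g x \<bullet> h)) (at x)"
    and S: "convex S" "p \<in> S" "q \<in> S"
    and orth: "\<And>x. x \<in> S \<Longrightarrow> g x \<bullet> (q - p) = 0"
  shows "u p = u q"
proof -
  have "((\<lambda>t. u (p + t *\<^sub>R (q - p))) has_real_derivative 0) (at t within {0..1})" if "t \<in> {0..1}" for t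
  proof -
    have "p + t *\<^sub>R (q - p) \<in> S"
      using convexD[OF S, of "1 - t" t] that by (simp add: algebra_simps)
    from has_real_derivative_along_line[OF deriv[OF this]] orth[OF this]
    show ?thesis by (simp add: has_field_derivative_at_within)
  qed
  then obtain c where "\<forall>t\<in>{0..1}. u (p + t *\<^sub>R (q - p)) = c"
    using has_field_derivative_zero_constant[of "{0..1::real}"] by (metis convex_closed_interval cbox_interval convex_box(1))
  from this[rule_format, of 0] this[rule_format, of 1] show ?thesis by simp
qed

context orthogonal_split
begin

text \<open>Where the derivative in a direction \<open>h\<close> of \<open>X\<close> is nonzero, the \<open>Y\<close>-gradient vanishes in a whole
  neighbourhood, so \<open>u\<close> does not depend there on the variable in \<open>Y\<close>, and neither does its
  \<open>h\<close>-derivative. Hence the set of points of the slice at which this derivative has the given nonzero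
  value is open as well as closed.\<close>

lemma gradient_const_along_slice:
  assumes A: "openin (top_of_set X) A" and B: "openin (top_of_set Y) B" and con: "connected B"
    and deriv: "\<And>x. x \<in> A + B \<Longrightarrow> (u has_derivative (\<lambda>h. g x \<bullet> h)) (at x)"
    and g: "continuous_on (A + B) g"
    and alt: "\<And>x. x \<in> A + B \<Longrightarrow> (\<forall>h\<in>X. g x \<bullet> h = 0) \<or> (\<forall>k\<in>Y. g x \<bullet> k = 0)"
    and a: "a \<in> A" and b: "b \<in> B" and h: "h \<in> X" "g (a + b) \<bullet> h \<noteq> 0" and y: "y \<in> B"
  shows "g (a + y) \<bullet> h = g (a + b) \<bullet> h"
proof -
  define T where "T = {y \<in> B. g (a + y) \<bullet> h = g (a + b) \<bullet> h}"
  have aB: "a + y \<in> A + B" if "y \<in> B" for y using a that by (rule set_plus_intro)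
  have "continuous_on B (\<lambda>y. g (a + y) \<bullet> h)"
    using aB by (intro continuous_intros continuous_on_compose2[OF g]) auto
  then have "closedin (top_of_set B) T"
    unfolding T_def by (rule continuous_closedin_preimage_constant)
  moreover have "openin (top_of_set B) T"
    unfolding openin_contains_ball
  proof (intro conjI ballI)
    show "T \<subseteq> B" by (auto simp: T_def)
    fix y assume y: "y \<in> T"
    then have "y \<in> B" by (simp add: T_def)
    define W where "W = (A + B) \<inter> (\<lambda>x. g x \<bullet> h) -` (- {0})"
    have "open W" unfolding W_def
      by (rule continuous_open_preimage) (use open_sum[OF A B] in \<open>auto intro!: continuous_intros g\<close>)
    moreover have "a + y \<in> W" using y h aB[OF \<open>y \<in> B\<close>] by (simp add: W_def T_def)
    ultimately obtain s where s: "s > 0" "ball (a + y) s \<subseteq> W"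
      unfolding open_contains_ball by blast
    have "g (a + y') \<bullet> h = g (a + y) \<bullet> h" if y': "y' \<in> ball y (s / 2)" "y' \<in> B" for y'
    proof -
      have YB: "y' - y \<in> Y" 
        using y'(2) \<open>y \<in> B\<close> openin_imp_subset[OF B] subspace_Y by (auto intro: subspace_diff)
      have "((\<lambda>t. u ((a + y) + t *\<^sub>R h)) has_real_derivative g (a + y) \<bullet> h) (at 0)"
        "((\<lambda>t. u ((a + y') + t *\<^sub>R h)) has_real_derivative g (a + y') \<bullet> h) (at 0)"
        using deriv[OF aB] y' \<open>y \<in> B\<close> by (auto intro!: has_real_derivative_along_line)
      moreover have "\<forall>\<^sub>F t in nhds 0. u ((a + y) + t *\<^sub>R h) = u ((a + y') + t *\<^sub>R h)"
      proof -
        have "((\<lambda>t. norm (t *\<^sub>R h)) \<longlongrightarrow> norm (0 *\<^sub>R h)) (nhds (0::real))"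
          by (intro tendsto_intros filterlim_ident)
        then have "\<forall>\<^sub>F t in nhds (0::real). norm (t *\<^sub>R h) < s / 2"
          by (rule order_tendstoD) (use s in simp)
        then show ?thesis
        proof (rule eventually_mono)
          fix t :: real assume t: "norm (t *\<^sub>R h) < s / 2"
          have "norm (y' - y + t *\<^sub>R h) < s"
            using t y'(1) norm_triangle_ineq[of "y' - y" "t *\<^sub>R h"]
            by (simp add: dist_norm norm_minus_commute)
          then have "a + y' + t *\<^sub>R h \<in> ball (a + y) s"
            unfolding mem_ball dist_commute[of "a + y"] by (simp add: dist_norm algebra_simps)
          moreover have "a + y + t *\<^sub>R h \<in> ball (a + y) s" using t s(1) by (simp add: dist_norm)
          moreover have "g x \<bullet> (a + y' + t *\<^sub>R h - (a + y + t *\<^sub>R h)) = 0" if "x \<in> ball (a + y) s" for x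
          proof -
            have "x \<in> A + B" "g x \<bullet> h \<noteq> 0" using that s(2) by (auto simp: W_def)
            then have "g x \<bullet> (y' - y) = 0" using alt h(1) YB by blast
            then show ?thesis by simp
          qed
          ultimately show "u ((a + y) + t *\<^sub>R h) = u ((a + y') + t *\<^sub>R h)"
            using s(2) deriv by (intro eq_of_orthogonal_gradient[where S = "ball (a + y) s" and g = g]) (auto simp: W_def)
        qed
      qed
      ultimately show ?thesis using DERIV_cong_ev[OF refl] DERIV_unique by metis
    qed
    then have "ball y (s / 2) \<inter> B \<subseteq> T" using y by (auto simp: T_def)
    then show "\<exists>e>0. ball y e \<inter> B \<subseteq> T" using s(1) half_gt_zero by blast
  qed
  ultimately have "T = {} \<or> T = B" using con unfolding connected_clopen by blast
  moreover have "b \<in> T" using b by (simp add: T_def)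
  ultimately show ?thesis using y unfolding T_def by blast
qed

lemma const_along_slice:
  assumes A: "openin (top_of_set X) A" and B: "openin (top_of_set Y) B" and con: "connected A"
    and deriv: "\<And>x. x \<in> A + B \<Longrightarrow> (u has_derivative (\<lambda>h. g x \<bullet> h)) (at x)"
    and zero: "\<And>x h. x \<in> A + B \<Longrightarrow> h \<in> X \<Longrightarrow> g x \<bullet> h = 0"
    and mem: "a \<in> A" "a' \<in> A" "b \<in> B"
  shows "u (a + b) = u (a' + b)"
proof (rule connected_local_const[OF con mem(1,2)], rule ballI)
  fix p assume p: "p \<in> A"
  then have "p + b \<in> A + B" using mem by blast
  then obtain s where s: "s > 0" "ball (p + b) s \<subseteq> A + B"
    using open_sum[OF A B] unfolding open_contains_ball by blast
  have "u (p + b) = u (q + b)" if q: "q \<in> A" "dist q p < s" for q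
  proof (rule eq_of_orthogonal_gradient[where S = "ball (p + b) s" and g = g])
    have "q - p \<in> X"
      using q p openin_imp_subset[OF A] subspace_X by (auto intro: subspace_diff)
    then show "g x \<bullet> (q + b - (p + b)) = 0" if "x \<in> ball (p + b) s" for x
      using zero that s(2) by auto
  qed (use s q deriv in \<open>auto simp: dist_norm norm_minus_commute\<close>)
  then show "\<forall>\<^sub>F q in at p within A. u (p + b) = u (q + b)"
    unfolding eventually_at using s(1) by blast
qed

end

context orthogonal_split
begin

text \<open>If the \<open>X\<close>-gradient were nonzero at \<open>a + b\<close> and the \<open>Y\<close>-gradient at \<open>a' + b'\<close>, then, both being
  preserved along slices, both would be nonzero at \<open>a + b'\<close>.\<close>

lemma gradient_dichotomy:
  assumes A: "openin (top_of_set X) A" and B: "openin (top_of_set Y) B"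
    and con: "connected A" "connected B"
    and deriv: "\<And>x. x \<in> A + B \<Longrightarrow> (u has_derivative (\<lambda>h. g x \<bullet> h)) (at x)"
    and g: "continuous_on (A + B) g"
    and alt: "\<And>x. x \<in> A + B \<Longrightarrow> (\<forall>h\<in>X. g x \<bullet> h = 0) \<or> (\<forall>k\<in>Y. g x \<bullet> k = 0)"
  shows "(\<forall>x\<in>A + B. \<forall>h\<in>X. g x \<bullet> h = 0) \<or> (\<forall>x\<in>A + B. \<forall>k\<in>Y. g x \<bullet> k = 0)"
proof (rule ccontr)
  assume "\<not> ?thesis"
  then obtain x h x' k where x: "x \<in> A + B" "h \<in> X" "g x \<bullet> h \<noteq> 0" "x' \<in> A + B" "k \<in> Y" "g x' \<bullet> k \<noteq> 0"
    by blast
  obtain a b where ab: "x = a + b" "a \<in> A" "b \<in> B" using x(1) by (rule set_plus_elim)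
  obtain a' b' where ab': "x' = a' + b'" "a' \<in> A" "b' \<in> B" using x(4) by (rule set_plus_elim)
  have "g (a + b') \<bullet> h \<noteq> 0"
    using gradient_const_along_slice[OF A B con(2) deriv g alt ab(2,3) x(2) _ ab'(3)] x(3) ab(1) by simp
  moreover have "g (b' + a) \<bullet> k \<noteq> 0"
  proof -
    have "g (b' + a) \<bullet> k = g (b' + a') \<bullet> k"
    proof (rule swapped.gradient_const_along_slice[OF B A con(1) _ _ _ ab'(3,2) x(5) _ ab(2)])
      show "(u has_derivative (\<bullet>) (g x)) (at x)" if "x \<in> B + A" for x
        using that deriv by (simp add: add.commute)
      show "continuous_on (B + A) g" using g by (simp add: add.commute)
      show "(\<forall>h\<in>Y. g x \<bullet> h = 0) \<or> (\<forall>k\<in>X. g x \<bullet> k = 0)" if "x \<in> B + A" for x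
        using that alt[of x] by (auto simp: add.commute)
      show "g (b' + a') \<bullet> k \<noteq> 0" using x(6) ab'(1) by (simp add: add.commute)
    qed
    then show ?thesis using x(6) ab'(1) by (simp add: add.commute)
  qed
  moreover have "a + b' \<in> A + B" using ab(2) ab'(3) by (rule set_plus_intro)
  ultimately show False using alt[of "a + b'"] x(2,5) by (auto simp: add.commute)
qed

end

section \<open>Membership in the class of functions of one variable\<close>

lemma continuous_on_measurable_lebesgue_subspace:
  fixes f :: "'a::euclidean_space \<Rightarrow> real"
  assumes f: "continuous_on A f" and "A \<subseteq> X"
  shows "f \<in> borel_measurable (restrict_space (lebesgue_subspace X) A)"
proof (rule measurableI)
  have space: "space (restrict_space (lebesgue_subspace X) A) = A"
    using assms by (auto simp: lebesgue_subspace_def space_restrict_space)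
  fix S :: "real set" assume "S \<in> sets borel"
  then have "f -` S \<inter> A \<in> sets (restrict_space borel A)"
    using measurable_sets[OF borel_measurable_continuous_on_restrict[OF f]]
    by (simp add: space_restrict_space)
  then obtain T where T: "T \<in> sets borel" "f -` S \<inter> A = A \<inter> T"
    by (auto simp: sets_restrict_space)
  have "X \<inter> T \<in> sets (lebesgue_subspace X)"
    unfolding lebesgue_subspace_def
    by (rule sets_completionI_sets) (use T in \<open>auto simp: sets_restrict_space\<close>)
  moreover have "f -` S \<inter> A = A \<inter> (X \<inter> T)" using T assms by blast
  ultimately show "f -` S \<inter> space (restrict_space (lebesgue_subspace X) A)
      \<in> sets (restrict_space (lebesgue_subspace X) A)"
    unfolding space by (auto simp: sets_restrict_space)
qed simp

context orthogonal_split
begin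

lemma S_functions_if_const_along_slices:
  fixes u :: "'a \<Rightarrow> real"
  assumes A: "openin (top_of_set X) A" and B: "openin (top_of_set Y) B"
    and u: "continuous_on (A + B) u" and b: "b \<in> B"
    and const: "\<And>x y. x \<in> A \<Longrightarrow> y \<in> B \<Longrightarrow> u (x + y) = u (x + b)"
  shows "\<exists>v \<in> borel_measurable (restrict_space (lebesgue_subspace X) A).
    AE x in lebesgue_on (A + B). u x = v (component X Y x)"
proof (rule bexI)
  have sub: "A \<subseteq> X" "B \<subseteq> Y" using A B by (auto dest: openin_imp_subset)
  have "u z = u (component X Y z + b)" if "z \<in> A + B" for z
    using that
  proof (rule set_plus_elim)
    fix x y assume z: "z = x + y" "x \<in> A" "y \<in> B"
    then have "component X Y z = x" using component_add sub by blast
    then show ?thesis using const z by simp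
  qed
  then show "AE x in lebesgue_on (A + B). u x = u (component X Y x + b)"
    by (intro AE_I2) (simp add: space_restrict_space)
  have "continuous_on A (\<lambda>x. u (x + b))"
    using b by (intro continuous_on_compose2[OF u]) (auto intro!: continuous_intros)
  then show "(\<lambda>x. u (x + b)) \<in> borel_measurable (restrict_space (lebesgue_subspace X) A)"
    using sub(1) by (rule continuous_on_measurable_lebesgue_subspace)
qed

end

section \<open>Finiteness and vanishing of the energy\<close>

theorem proposition4:
  fixes X1 X2 \<Omega>1 \<Omega>2 :: "(real ^ 'n) set"
    and \<rho> :: "real ^ 'n \<Rightarrow> real"
    and n1 n2 :: nat
    and \<theta>1 \<theta>2 \<theta> :: real
  assumes "n1 \<ge> 1" and "n2 \<ge> 1" and "CARD('n) = n1 + n2"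
    and "subspace X1" and "subspace X2" and "dim X1 = n1" and "dim X2 = n2"
    and "X1 + X2 = UNIV"
    and "\<forall>x\<in>X1. \<forall>y\<in>X2. orthogonal x y"
    and "\<Omega>1 \<noteq> {}" and "bounded \<Omega>1" and "connected \<Omega>1" and "openin (top_of_set X1) \<Omega>1"
    and "\<Omega>2 \<noteq> {}" and "bounded \<Omega>2" and "connected \<Omega>2" and "openin (top_of_set X2) \<Omega>2"
    and "integrable lebesgue \<rho>" and "\<forall>z. \<rho> z \<ge> 0" and "radial \<rho>"
    and "integral\<^sup>L lebesgue \<rho> = 1" and "ess_support \<rho> \<subseteq> cball 0 1"
    and "\<theta>1 > 0" and "\<theta>2 > 0" and "\<theta> = \<theta>1 + \<theta>2"
  shows "(\<forall>u. (\<exists>L. L-lipschitz_on (\<Omega>1 + \<Omega>2) u) \<longrightarrow>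
            energy \<rho> X1 X2 \<Omega>1 \<Omega>2 \<theta>1 \<theta>2 \<theta> u < \<infinity> \<and>
            (\<forall>p. 0 < p \<and> p < \<theta> \<longrightarrow> energy \<rho> X1 X2 \<Omega>1 \<Omega>2 \<theta>1 \<theta>2 p u = 0)) \<and>
         (\<forall>u. C1_closure (\<Omega>1 + \<Omega>2) u \<and> energy \<rho> X1 X2 \<Omega>1 \<Omega>2 \<theta>1 \<theta>2 \<theta> u = 0 \<longrightarrow>
            u \<in> S_functions X1 X2 \<Omega>1 \<Omega>2)"
proof -
  interpret orthogonal_split X1 X2
    by standard (use assms in \<open>auto simp: orthogonal_def\<close>)
  note open1 = \<open>openin (top_of_set X1) \<Omega>1\<close> and open2 = \<open>openin (top_of_set X2) \<Omega>2\<close>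
  have open12: "open (\<Omega>1 + \<Omega>2)" by (rule open_sum[OF open1 open2])
  have \<rho>_meas: "\<rho> \<in> borel_measurable lebesgue" and \<rho>_nonneg: "\<And>z. \<rho> z \<ge> 0"
    using assms by auto
  have \<rho>_mass: "(\<integral>\<^sup>+ z. ennreal (\<rho> z) \<partial>lebesgue) = 1"
    using assms by (subst nn_integral_eq_integral) auto
  have "AE z in lebesgue. z \<notin> cball 0 1 \<longrightarrow> \<rho> z = 0"
    using \<open>ess_support \<rho> \<subseteq> cball 0 1\<close> by (rule ess_support_AE)
  moreover have "AE z in lebesgue. z \<notin> sphere (0 :: real ^ 'n) 1"
    using negligible_sphere[of "0 :: real ^ 'n" 1] by (intro AE_not_in) (simp add: negligible_iff_null_sets)
  \<comment> \<open>the domains are shrunk by increments with \<open>norm z < \<epsilon>\<close> only, hence the null sphere is removed\<close>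
  ultimately have supp: "AE z in lebesgue. 1 \<le> norm z \<longrightarrow> \<rho> z = 0"
    by eventually_elim auto
  have finite: "emeasure lebesgue (\<Omega>1 + \<Omega>2) \<noteq> top"
  proof -
    have "\<Omega>1 + \<Omega>2 = (\<Union>x\<in>\<Omega>1. \<Union>y\<in>\<Omega>2. {x + y})" by (auto simp: set_plus_def)
    then have "bounded (\<Omega>1 + \<Omega>2)" using bounded_sums[OF \<open>bounded \<Omega>1\<close> \<open>bounded \<Omega>2\<close>] by simp
    then have "\<Omega>1 + \<Omega>2 \<in> lmeasurable" using open12 by (simp add: bounded_set_imp_lmeasurable)
    then show ?thesis by (rule fmeasurableD2)
  qed
  have lip: "energy \<rho> X1 X2 \<Omega>1 \<Omega>2 \<theta>1 \<theta>2 \<theta> u < \<infinity> \<and>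
      (\<forall>p. 0 < p \<and> p < \<theta> \<longrightarrow> energy \<rho> X1 X2 \<Omega>1 \<Omega>2 \<theta>1 \<theta>2 p u = 0)"
    if u: "L-lipschitz_on (\<Omega>1 + \<Omega>2) u" for u L
  proof -
    define m where "m = measure lebesgue (\<Omega>1 + \<Omega>2)"
    have "emeasure lebesgue (\<Omega>1 + \<Omega>2) = ennreal m"
      unfolding m_def using finite by (rule emeasure_eq_ennreal_measure)
    then have bound: "energy_eps \<rho> X1 X2 \<Omega>1 \<Omega>2 \<theta>1 \<theta>2 p \<epsilon> u \<le> ennreal (L powr \<theta> * \<epsilon> powr (\<theta> - p) * m)"
      if "p \<le> \<theta>" "0 < \<epsilon>" for p \<epsilon>
      using energy_eps_le[OF open1 open2 u \<open>\<theta>1 > 0\<close> \<open>\<theta>2 > 0\<close> that(2) _ \<rho>_meas \<rho>_nonneg \<rho>_mass supp, of p] that(1)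
        \<open>\<theta> = \<theta>1 + \<theta>2\<close>
      by (simp add: ennreal_mult m_def)
    have le: "\<forall>\<^sub>F \<epsilon> in at_right 0. energy_eps \<rho> X1 X2 \<Omega>1 \<Omega>2 \<theta>1 \<theta>2 p \<epsilon> u
        \<le> ennreal (L powr \<theta> * \<epsilon> powr (\<theta> - p) * m)" if "p \<le> \<theta>" for p
      by (rule eventually_mono[OF eventually_at_right_less bound[OF that]])
    have energy_le: "energy \<rho> X1 X2 \<Omega>1 \<Omega>2 \<theta>1 \<theta>2 p u \<le> c"
      if "p \<le> \<theta>" "((\<lambda>\<epsilon>. ennreal (L powr \<theta> * \<epsilon> powr (\<theta> - p) * m)) \<longlongrightarrow> c) (at_right 0)" for p c
    proof -
      have "energy \<rho> X1 X2 \<Omega>1 \<Omega>2 \<theta>1 \<theta>2 p u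
          \<le> Liminf (at_right 0) (\<lambda>\<epsilon>. ennreal (L powr \<theta> * \<epsilon> powr (\<theta> - p) * m))"
        unfolding energy_def by (rule Liminf_mono[OF le[OF that(1)]])
      also have "\<dots> = c" by (rule lim_imp_Liminf[OF trivial_limit_at_right_real that(2)])
      finally show ?thesis .
    qed
    have "energy \<rho> X1 X2 \<Omega>1 \<Omega>2 \<theta>1 \<theta>2 \<theta> u \<le> ennreal (L powr \<theta> * 1 * m)"
    proof (rule energy_le)
      have "\<forall>\<^sub>F \<epsilon> in at_right (0::real). \<epsilon> > 0" by (rule eventually_at_right_less)
      then have "\<forall>\<^sub>F \<epsilon> in at_right (0::real). ennreal (L powr \<theta> * 1 * m) = ennreal (L powr \<theta> * \<epsilon> powr (\<theta> - \<theta>) * m)"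
        by eventually_elim simp
      then show "((\<lambda>\<epsilon>. ennreal (L powr \<theta> * \<epsilon> powr (\<theta> - \<theta>) * m)) \<longlongrightarrow> ennreal (L powr \<theta> * 1 * m)) (at_right 0)"
        by (rule tendsto_cong[THEN iffD1, OF _ tendsto_const])
    qed simp
    moreover have "energy \<rho> X1 X2 \<Omega>1 \<Omega>2 \<theta>1 \<theta>2 p u = 0" if "0 < p" "p < \<theta>" for p
    proof -
      have "\<forall>\<^sub>F \<epsilon> in at_right (0::real). 0 \<le> \<epsilon>"
        by (rule eventually_mono[OF eventually_at_right_less less_imp_le])
      then have "((\<lambda>\<epsilon>::real. \<epsilon> powr (\<theta> - p)) \<longlongrightarrow> 0 powr (\<theta> - p)) (at_right 0)"
        using that by (intro tendsto_powr2 tendsto_ident_at tendsto_const) auto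
      then have "((\<lambda>\<epsilon>::real. \<epsilon> powr (\<theta> - p)) \<longlongrightarrow> 0) (at_right 0)"
        by simp
      then have "((\<lambda>\<epsilon>. ennreal (L powr \<theta> * \<epsilon> powr (\<theta> - p) * m)) \<longlongrightarrow> ennreal (L powr \<theta> * 0 * m)) (at_right 0)"
        by (intro tendsto_ennrealI tendsto_intros)
      from energy_le[OF _ this] show ?thesis using that by simp
    qed
    ultimately show ?thesis by (auto simp: less_top[symmetric] top_unique)
  qed
  have "u \<in> S_functions X1 X2 \<Omega>1 \<Omega>2"
    if C1: "C1_closure (\<Omega>1 + \<Omega>2) u" and energy: "energy \<rho> X1 X2 \<Omega>1 \<Omega>2 \<theta>1 \<theta>2 \<theta> u = 0" for u
  proof -
    obtain g where g': "continuous_on (closure (\<Omega>1 + \<Omega>2)) g"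
      and within: "\<forall>x\<in>\<Omega>1 + \<Omega>2. (u has_derivative (\<lambda>h. g x \<bullet> h)) (at x within \<Omega>1 + \<Omega>2)"
      using C1 unfolding C1_closure_def by blast
    have g: "continuous_on (\<Omega>1 + \<Omega>2) g" using g' closure_subset by (rule continuous_on_subset)
    have deriv: "(u has_derivative (\<lambda>h. g x \<bullet> h)) (at x)" if "x \<in> \<Omega>1 + \<Omega>2" for x
      using within that at_within_open[OF that open12] by metis
    have cont: "continuous_on (\<Omega>1 + \<Omega>2) u"
      using deriv by (intro continuous_at_imp_continuous_on ballI) (rule has_derivative_continuous)
    have "(\<forall>h\<in>X1. g x \<bullet> h = 0) \<or> (\<forall>k\<in>X2. g x \<bullet> k = 0)" if "x \<in> \<Omega>1 + \<Omega>2" for x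
      using energy_pos[OF open1 open2 deriv g that _ _ _ _ \<rho>_meas \<rho>_nonneg _ \<open>\<theta>1 > 0\<close> \<open>\<theta>2 > 0\<close>]
        \<rho>_mass energy \<open>\<theta> = \<theta>1 + \<theta>2\<close> by (metis zero_neq_one)
    then have "(\<forall>x\<in>\<Omega>1 + \<Omega>2. \<forall>h\<in>X1. g x \<bullet> h = 0) \<or> (\<forall>x\<in>\<Omega>1 + \<Omega>2. \<forall>k\<in>X2. g x \<bullet> k = 0)"
      using gradient_dichotomy[OF open1 open2 \<open>connected \<Omega>1\<close> \<open>connected \<Omega>2\<close> deriv g] by blast
    then have "(\<exists>u1 \<in> borel_measurable (restrict_space (lebesgue_subspace X1) \<Omega>1).
           AE x in lebesgue_on (\<Omega>1 + \<Omega>2). u x = u1 (component X1 X2 x)) \<or>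
        (\<exists>u2 \<in> borel_measurable (restrict_space (lebesgue_subspace X2) \<Omega>2).
           AE x in lebesgue_on (\<Omega>1 + \<Omega>2). u x = u2 (component X2 X1 x))"
    proof
      assume zero: "\<forall>x\<in>\<Omega>1 + \<Omega>2. \<forall>h\<in>X1. g x \<bullet> h = 0"
      obtain a where a: "a \<in> \<Omega>1" using \<open>\<Omega>1 \<noteq> {}\<close> by blast
      have const: "u (y + x) = u (y + a)" if "y \<in> \<Omega>2" "x \<in> \<Omega>1" for y x
        using const_along_slice[OF open1 open2 \<open>connected \<Omega>1\<close> deriv _ that(2) a that(1)] zero
        by (simp add: add.commute)
      have comm: "\<Omega>2 + \<Omega>1 = \<Omega>1 + \<Omega>2" by (rule add.commute)
      have "continuous_on (\<Omega>2 + \<Omega>1) u" using cont unfolding comm .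
      from swapped.S_functions_if_const_along_slices[OF open2 open1 this a const]
      show ?thesis unfolding comm by blast
    next
      assume zero: "\<forall>x\<in>\<Omega>1 + \<Omega>2. \<forall>k\<in>X2. g x \<bullet> k = 0"
      obtain b where b: "b \<in> \<Omega>2" using \<open>\<Omega>2 \<noteq> {}\<close> by blast
      have "u (x + y) = u (x + b)" if "x \<in> \<Omega>1" "y \<in> \<Omega>2" for x y
        using swapped.const_along_slice[OF open2 open1 \<open>connected \<Omega>2\<close> _ _ that(2) b that(1), of u g] zero deriv
        by (simp add: add.commute)
      then show ?thesis
        using S_functions_if_const_along_slices[OF open1 open2 cont b] by blast
    qed
    moreover have "u \<in> borel_measurable (lebesgue_on (\<Omega>1 + \<Omega>2))"
      using cont open12 by (intro continuous_imp_measurable_on_sets_lebesgue) (simp_all add: borel_open)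
    ultimately show ?thesis unfolding S_functions_def by blast
  qed
  with lip show ?thesis by blast
qed

end
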